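(* The mapping $\mathcal{R}:\mathcal{M}\to\mathbb{R}^{3\times3}$ is a faithful representation of the special Sturmian monoid $\mathcal{M}$, i.e., $\mathcal{R}$ is an injective monoid homomorphism from $\mathcal{M}$ (with composition) to $\mathbb{R}^{3\times 3}$ (with matrix multiplication).
   Context: Let $G,\widetilde G,D,\widetilde D$ be the morphisms of the free monoid $\{0,1\}^*$ given by $G:0\mapsto 0,\,1\mapsto 01$; $\widetilde G:0\mapsto 0,\,1\mapsto 10$; $D:0\mapsto 10,\,1\mapsto 1$; $\widetilde D:0\mapsto 01,\,1\mapsto 1$. The special Sturmian monoid is $\mathcal{M}=\langle G,\widetilde G,D,\widetilde D\rangle$, the monoid they generate under composition (including the identity). Put $$R_{\widetilde G}=\begin{pmatrix}1&1&0\\0&1&0\\0&1&1\end{pmatrix},\quad R_G=\begin{pmatrix}1&1&0\\0&1&0\\0&0&1\end{pmatrix},\quad R_{\widetilde D}=\begin{pmatrix}1&0&0\\1&1&0\\0&0&1\end{pmatrix},\quad R_D=\begin{pmatrix}1&0&0\\1&1&0\\1&0&1\end{pmatrix}.$$ For $\psi=\varphi_1\circ\cdots\circ\varphi_n\in\mathcal{M}$ with $\varphi_i\in\{G,\widetilde G,D,\widetilde D\}$, define $\mathcal{R}(\psi)=R_{\varphi_1}R_{\varphi_2}\cdots R_{\varphi_n}$ (identity matrix if $n=0$); this does not depend on the chosen decomposition of $\psi$, since it is known that $\mathcal{M}$ is presented by the relations $GD^k\widetilde G=\widetilde G\widetilde D^kG$ and $DG^k\widetilde D=\widetilde D\widetilde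 G^kD$ ($k\in\mathbb{N}$), and the corresponding matrix relations hold. *)

theory Defs
  imports "HOL-Analysis.Analysis"
begin

datatype letter = L0 | L1

definition subst :: "letter list \<Rightarrow> letter list \<Rightarrow> letter list \<Rightarrow> letter list" where
  "subst u v w = concat (map (\<lambda>a. case a of L0 \<Rightarrow> u | L1 \<Rightarrow> v) w)"

text \<open>The suffix \<open>t\<close> stands for a tilde.\<close>

definition morph_G :: "letter list \<Rightarrow> letter list" where
  "morph_G = subst [L0] [L0, L1]"

definition morph_Gt :: "letter list \<Rightarrow> letter list" where
  "morph_Gt = subst [L0] [L1, L0]"

definition morph_D :: "letter list \<Rightarrow> letter list" where
  "morph_D = subst [L1, L0] [L1]"

definition morph_Dt :: "letter list \<Rightarrow> letter list" where
  "morph_Dt = subst [L0, L1] [L1]"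

inductive_set special_sturmian :: "(letter list \<Rightarrow> letter list) set" where
  id: "id \<in> special_sturmian"
| gen: "\<phi> \<in> {morph_G, morph_Gt, morph_D, morph_Dt} \<Longrightarrow> \<phi> \<in> special_sturmian"
| comp: "\<phi> \<in> special_sturmian \<Longrightarrow> \<psi> \<in> special_sturmian \<Longrightarrow> \<phi> \<circ> \<psi> \<in> special_sturmian"

definition mat_Gt :: "real^3^3" where
  "mat_Gt = vector [vector [1, 1, 0], vector [0, 1, 0], vector [0, 1, 1]]"

definition mat_G :: "real^3^3" where
  "mat_G = vector [vector [1, 1, 0], vector [0, 1, 0], vector [0, 0, 1]]"

definition mat_Dt :: "real^3^3" where
  "mat_Dt = vector [vector [1, 0, 0], vector [1, 1, 0], vector [0, 0, 1]]"

definition mat_D :: "real^3^3" where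
  "mat_D = vector [vector [1, 0, 0], vector [1, 1, 0], vector [1, 0, 1]]"

definition gen_pairs :: "((letter list \<Rightarrow> letter list) \<times> (real^3^3)) set" where
  "gen_pairs = {(morph_G, mat_G), (morph_Gt, mat_Gt), (morph_D, mat_D), (morph_Dt, mat_Dt)}"

text \<open>A decomposition of a morphism is encoded as a list of pairs of a generator and its matrix.
  Existence and uniqueness of the described matrix, for every member of the monoid, are proved in
  \<open>special_sturmian_decomposes\<close> and \<open>sturmian_rep_decomposition\<close> below.\<close>

definition sturmian_rep :: "(letter list \<Rightarrow> letter list) \<Rightarrow> real^3^3" where
  "sturmian_rep \<psi> = (THE A. \<exists>ps. set ps \<subseteq> gen_pairs \<and>
     \<psi> = foldr (\<circ>) (map fst ps) id \<and> A = foldr (**) (map snd ps) (mat 1))"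

lemma special_sturmian_decomposes:
  assumes "\<psi> \<in> special_sturmian"
  shows "\<exists>ps. set ps \<subseteq> gen_pairs \<and> \<psi> = foldr (\<circ>) (map fst ps) id"
  using assms
proof induction
  case id
  show ?case by (rule exI[of _ "[]"]) auto
next
  case (gen \<phi>)
  then obtain A where "(\<phi>, A) \<in> gen_pairs"
    by (auto simp: gen_pairs_def)
  then show ?case by (intro exI[of _ "[(\<phi>, A)]"]) auto
next
  case (comp \<phi> \<psi>)
  then obtain ps qs where dec:
    "set ps \<subseteq> gen_pairs" "\<phi> = foldr (\<circ>) (map fst ps) id"
    "set qs \<subseteq> gen_pairs" "\<psi> = foldr (\<circ>) (map fst qs) id" by blast
  have *: "foldr (\<circ>) fs g = foldr (\<circ>) fs id \<circ> g"
    for fs and g :: "letter list \<Rightarrow> letter list"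
    by (induction fs) (auto simp: comp_assoc)
  have "foldr (\<circ>) (map fst (ps @ qs)) id =
      foldr (\<circ>) (map fst ps) id \<circ> foldr (\<circ>) (map fst qs) id"
    unfolding map_append foldr_append by (rule *)
  with dec show ?case by (intro exI[of _ "ps @ qs"]) (simp only: set_append Un_subset_iff)
qed

text \<open>Well-definedness needs no presentation of the monoid: the matrix can be read off the morphism.
  Its upper left block is the incidence matrix, and its last row is determined by that block and
  the Parikh vector of the longest common prefix \<open>w\<close> of the images of 01 and 10.\<close>

definition rep_spec :: "(letter list \<Rightarrow> letter list) \<Rightarrow> letter list \<Rightarrow> real^3^3 \<Rightarrow> bool" where
  "rep_spec f w A \<longleftrightarrow> (\<exists>v. f [L0, L1] = w @ L0 # L1 # v \<and> f [L1, L0] = w @ L1 # L0 # v) \<and>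
     A = vector [
       vector [real (count_list (f [L0]) L0), real (count_list (f [L1]) L0), 0],
       vector [real (count_list (f [L0]) L1), real (count_list (f [L1]) L1), 0],
       vector [real (count_list (f [L0]) L0) - 1
                 - real (count_list w L0) * real (count_list (f [L0]) L1)
                 + real (count_list w L1) * real (count_list (f [L0]) L0),
               real (count_list (f [L1]) L0)
                 - real (count_list w L0) * real (count_list (f [L1]) L1)
                 + real (count_list w L1) * real (count_list (f [L1]) L0), 1]]"

lemma subst_simps [simp]:
  "subst u v [] = []"
  "subst u v (L0 # w) = u @ subst u v w"
  "subst u v (L1 # w) = v @ subst u v w"
  "subst u v (x @ y) = subst u v x @ subst u v y"
  by (simp_all add: subst_def)

lemma count_subst:
  "count_list (subst u v w) a =
     count_list w L0 * count_list u a + count_list w L1 * count_list v a"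
proof (induction w)
  case (Cons b w)
  then show ?case by (cases b) (auto simp: algebra_simps)
qed simp

lemma block_mult:
  "(vector [vector [a, b, 0], vector [c, d, 0], vector [e, f, 1]] :: real^3^3) **
     (vector [vector [a', b', 0], vector [c', d', 0], vector [e', f', 1]] :: real^3^3) =
   vector [vector [a * a' + b * c', a * b' + b * d', 0],
     vector [c * a' + d * c', c * b' + d * d', 0],
     vector [e * a' + f * c' + e', e * b' + f * d' + f', 1]]"
  unfolding matrix_matrix_mult_def vec_eq_iff forall_3 vec_lambda_beta sum_3
  by simp

lemma block_cong:
  assumes "a = a'" "b = b'" "c = c'" "d = d'" "e = e'" "f = f'"
  shows "(vector [vector [a, b, 0], vector [c, d, 0], vector [e, f, 1]] :: real^3^3) =
    vector [vector [a', b', 0], vector [c', d', 0], vector [e', f', 1]]"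
  using assms by simp

lemma rep_spec_comp:
  assumes "rep_spec f w A" "(g, B) \<in> gen_pairs"
  shows "\<exists>w'. rep_spec (g \<circ> f) w' (B ** A)"
proof -
  from assms(1) obtain v where w: "f [L0, L1] = w @ L0 # L1 # v" "f [L1, L0] = w @ L1 # L0 # v"
    unfolding rep_spec_def by blast
  note A = assms(1)[unfolded rep_spec_def, THEN conjunct2]
  from assms(2) consider "g = morph_G" "B = mat_G" | "g = morph_Gt" "B = mat_Gt"
    | "g = morph_D" "B = mat_D" | "g = morph_Dt" "B = mat_Dt"
    by (auto simp: gen_pairs_def)
  then show ?thesis
  proof cases
    case 1
    have "rep_spec (g \<circ> f) (g w @ [L0]) (B ** A)"
      unfolding rep_spec_def A 1(2) mat_G_def block_mult
      by (intro conjI block_cong)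
        (simp_all add: w 1(1) morph_G_def count_subst algebra_simps)
    then show ?thesis by blast
  next
    case 2
    have "rep_spec (g \<circ> f) (g w) (B ** A)"
      unfolding rep_spec_def A 2(2) mat_Gt_def block_mult
      by (intro conjI block_cong)
        (simp_all add: w 2(1) morph_Gt_def count_subst algebra_simps)
    then show ?thesis by blast
  next
    case 3
    have "rep_spec (g \<circ> f) (g w @ [L1]) (B ** A)"
      unfolding rep_spec_def A 3(2) mat_D_def block_mult
      by (intro conjI block_cong)
        (simp_all add: w 3(1) morph_D_def count_subst algebra_simps)
    then show ?thesis by blast
  next
    case 4
    have "rep_spec (g \<circ> f) (g w) (B ** A)"
      unfolding rep_spec_def A 4(2) mat_Dt_def block_mult
      by (intro conjI block_cong)
        (simp_all add: w 4(1) morph_Dt_def count_subst algebra_simps)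
    then show ?thesis by blast
  qed
qed

lemma rep_spec_decomposition:
  assumes "set ps \<subseteq> gen_pairs"
  shows "\<exists>w. rep_spec (foldr (\<circ>) (map fst ps) id) w (foldr (**) (map snd ps) (mat 1))"
  using assms
proof (induction ps)
  case Nil
  have "rep_spec (foldr (\<circ>) (map fst []) id) [] (foldr (**) (map snd []) (mat 1))"
    by (auto simp: rep_spec_def vec_eq_iff forall_3 mat_def)
  then show ?case by blast
next
  case (Cons p ps)
  then obtain w where
    "rep_spec (foldr (\<circ>) (map fst ps) id) w (foldr (**) (map snd ps) (mat 1))"
    by (metis insert_subset list.simps(15))
  then have "\<exists>w'. rep_spec (fst p \<circ> foldr (\<circ>) (map fst ps) id) w'
      (snd p ** foldr (**) (map snd ps) (mat 1))"
    using Cons.prems by (intro rep_spec_comp) auto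
  moreover have "foldr (\<circ>) (map fst (p # ps)) id = fst p \<circ> foldr (\<circ>) (map fst ps) id"
    and "foldr (**) (map snd (p # ps)) (mat 1) = snd p ** foldr (**) (map snd ps) (mat 1)"
    by simp_all
  ultimately show ?case by (simp only:)
qed

lemma rep_spec_unique:
  assumes "rep_spec f w A" "rep_spec f w' A'"
  shows "A = A'"
proof -
  have *: "x = x'"
    if "x @ L0 # y = x' @ L0 # y'" "x @ L1 # z = x' @ L1 # z'" for x x' y y' z z'
    using that
  proof (induction x arbitrary: x')
    case Nil
    then show ?case by (cases x') auto
  next
    case (Cons a x)
    then show ?case by (cases x') auto
  qed
  obtain v v' where "w @ L0 # L1 # v = w' @ L0 # L1 # v'" "w @ L1 # L0 # v = w' @ L1 # L0 # v'"
    using assms unfolding rep_spec_def by metis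
  then have "w = w'" by (rule *)
  with assms show ?thesis by (simp add: rep_spec_def)
qed

lemma sturmian_rep_decomposition:
  assumes "set ps \<subseteq> gen_pairs"
  shows "sturmian_rep (foldr (\<circ>) (map fst ps) id) = foldr (**) (map snd ps) (mat 1)"
  unfolding sturmian_rep_def
proof (rule the_equality)
  show "\<exists>qs. set qs \<subseteq> gen_pairs \<and> foldr (\<circ>) (map fst ps) id = foldr (\<circ>) (map fst qs) id \<and>
      foldr (**) (map snd ps) (mat 1) = foldr (**) (map snd qs) (mat 1)"
    using assms by blast
next
  fix A
  assume "\<exists>qs. set qs \<subseteq> gen_pairs \<and> foldr (\<circ>) (map fst ps) id = foldr (\<circ>) (map fst qs) id \<and>
      A = foldr (**) (map snd qs) (mat 1)"
  then show "A = foldr (**) (map snd ps) (mat 1)"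
    using rep_spec_decomposition assms rep_spec_unique by metis
qed

end

theory Submission
  imports Defs
begin

text \<open>Injectivity: the upper left block of \<open>\<R>(\<psi>)\<close> gives the lengths of \<open>\<psi>(0)\<close> and \<open>\<psi>(1)\<close>, and,
  since that block is invertible, the last row gives the Parikh vector, hence the length, of the
  longest common prefix \<open>w\<close> of \<open>\<psi>(01) = w01z\<close> and \<open>\<psi>(10) = w10z\<close>. A Euclidean descent shows that
  these three lengths determine \<open>\<psi>(0)\<close> and \<open>\<psi>(1)\<close>: the shorter of the two images is a prefix or a
  suffix of the longer one, and cancelling it there leaves a smaller pair of the same kind.\<close>

section \<open>Words \<open>u\<close>, \<open>v\<close> whose products differ by one adjacent
  swap\<close>

text \<open>One Euclidean step on the left: \<open>u\<close> fits inside the common prefix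
  \<open>w\<close>, so cancelling it in both equations shortens \<open>v\<close> and
  \<open>w\<close> by \<open>length u\<close> and keeps \<open>z\<close>.\<close>

lemma almost_commuting_prefix:
  assumes "u @ v = w @ a # b # z" "v @ u = w @ b # a # z"
    and "length u \<le> length v" "length u \<le> length w"
  obtains v' w' where "v = u @ v'" "w = u @ w'"
    "u @ v' = w' @ a # b # z" "v' @ u = w' @ b # a # z"
proof -
  have split: "\<exists>t. q = p @ t \<and> r = t @ s"
    if "p @ r = q @ s" "length p \<le> length q" for p q r s :: "'a list"
    using that by (metis append_eq_append_conv_if append_take_drop_id)
  obtain w' where w: "w = u @ w'" "v = w' @ a # b # z"
    using split[OF assms(1,4)] by blast
  have "u @ w' @ b # a # z = v @ u"
    using assms(2) w(1) by simp
  then obtain v' where v: "v = u @ v'" "w' @ b # a # z = v' @ u"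
    using split assms(3) by blast
  show thesis
    using that[OF v(1) w(1)] v w(2) by simp
qed

text \<open>The mirror image: here \<open>z\<close> is shortened and \<open>w\<close> is kept.
  Reversal exchanges the two products and also the two letters, so \<open>a\<close> and
  \<open>b\<close> keep their places.\<close>

lemma almost_commuting_suffix:
  assumes "u @ v = w @ a # b # z" "v @ u = w @ b # a # z"
    and "length u \<le> length v" "length u \<le> length z"
  obtains v' z' where "v = v' @ u" "u @ v' = w @ a # b # z'" "v' @ u = w @ b # a # z'"
proof -
  have "rev u @ rev v = rev z @ a # b # rev w" "rev v @ rev u = rev z @ b # a # rev w"
    using assms(1,2)[THEN arg_cong[where f = rev]] by simp_all
  then obtain v' z' where *: "rev v = rev u @ v'"
    "rev u @ v' = z' @ a # b # rev w" "v' @ rev u = z' @ b # a # rev w"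
    using assms(3,4) almost_commuting_prefix[of "rev u" "rev v" "rev z" a b "rev w"]
    by (metis length_rev)
  show thesis
    using *[THEN arg_cong[where f = rev]] by (intro that[of "rev v'" "rev z'"]) simp_all
qed

text \<open>Base case of the descent. If \<open>u\<close> fitted into \<open>w\<close> or
  \<open>z\<close>, cancellation would give \<open>u = v\<close>, against
  \<open>a \<noteq> b\<close>; counting letters then puts the swap exactly across the boundary
  between the two factors.\<close>

lemma almost_commuting_same_length:
  assumes "u @ v = w @ a # b # z" "v @ u = w @ b # a # z"
    and "a \<noteq> b" "length u = length v"
  shows "u = [a] \<and> v = [b]"
proof -
  have neq: "u \<noteq> v" using assms(1,2,3) by auto
  have "\<not> length u \<le> length w"
    using almost_commuting_prefix[OF assms(1,2)] neq assms(4)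
    by (metis append_eq_conv_conj append_Nil2 order_refl take_all)
  moreover have "\<not> length u \<le> length z"
    using almost_commuting_suffix[OF assms(1,2)] neq assms(4)
    by (metis append_eq_append_conv append_Nil order_refl)
  moreover have "length u + length v = length w + length z + 2"
    using assms(1)[THEN arg_cong[where f = length]] by simp
  ultimately have len: "length u = Suc (length w)" "length v = Suc (length w)"
    "length v = Suc (length z)"
    using assms(4) by linarith+
  have "u = w @ [a]" "v = b # z"
    using assms(1) len append_eq_append_conv[of u "w @ [a]" v "b # z"] by simp_all
  moreover have "v = w @ [b]" "u = a # z"
    using assms(2) len append_eq_append_conv[of v "w @ [b]" u "a # z"] by simp_all
  ultimately have eqs: "w @ [a] = a # z" "w @ [b] = b # z"
    by simp_all
  \<comment> \<open>A nonempty \<open>w\<close> would begin with both \<open>a\<close> and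
    \<open>b\<close>.\<close>
  have "w = []"
  proof (cases w)
    case (Cons c w')
    then show ?thesis using eqs assms(3) by simp
  qed
  then show ?thesis
    using \<open>u = w @ [a]\<close> \<open>v = w @ [b]\<close> by simp
qed

text \<open>The lengths alone decide which descent step applies, so both pairs undergo the same step
  and the induction hypothesis identifies the remainders.\<close>

lemma almost_commuting_pair_unique:
  assumes "u @ v = w @ a # b # z" "v @ u = w @ b # a # z"
    and "u' @ v' = w' @ a # b # z'" "v' @ u' = w' @ b # a # z'"
    and "a \<noteq> b" "length u = length u'" "length v = length v'" "length w = length w'"
  shows "u = u' \<and> v = v'"
  using assms
proof (induction "length u + length v" arbitrary: u v w z u' v' w' z' a b rule: less_induct)
  case less
  \<comment> \<open>Stated for fresh names so that it serves \<open>(u, v)\<close> and also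
    \<open>(v, u)\<close>, where the letters are exchanged; hence \<open>a\<close> and
    \<open>b\<close> vary in the induction.\<close>
  have shorter: "x = x' \<and> y = y'"
    if eq: "x @ y = w @ c # d # z" "y @ x = w @ d # c # z"
      "x' @ y' = w' @ c # d # z'" "y' @ x' = w' @ d # c # z'"
      and "c \<noteq> d" and len: "length x = length x'" "length y = length y'"
      and lt: "length x < length y" and sum: "length x + length y = length u + length v"
    for x y x' y' c d
  proof -
    \<comment> \<open>An empty \<open>x\<close> would make the products equal; nonemptiness makes
      the total length drop.\<close>
    have "x \<noteq> []" using eq(1,2) \<open>c \<noteq> d\<close> by auto
    then have pos: "0 < length x" by simp
    have total: "length x + length y = length w + length z + 2"
      "length x' + length y' = length w' + length z' + 2"
      using eq(1,3)[THEN arg_cong[where f = length]] by simp_all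
    \<comment> \<open>If \<open>x\<close> were longer than both, then
      \<open>2 * length x \<ge> length w + length z + 2\<close>, which contradicts
      \<open>total\<close> because \<open>y\<close> is longer still.\<close>
    consider "length x \<le> length w" | "length x \<le> length z"
      using total lt by linarith
    then show ?thesis
    proof cases
      case 1
      obtain r s where r: "y = x @ r" "w = x @ s" "x @ r = s @ c # d # z" "r @ x = s @ d # c # z"
        using almost_commuting_prefix[OF eq(1,2)] lt 1 by (metis less_imp_le)
      obtain r' s' where r': "y' = x' @ r'" "w' = x' @ s'"
        "x' @ r' = s' @ c # d # z'" "r' @ x' = s' @ d # c # z'"
        using almost_commuting_prefix[OF eq(3,4)] lt 1 len less.prems(8) by (metis less_imp_le)
      have "x = x' \<and> r = r'"
      proof (rule less.hyps[OF _ r(3,4) r'(3,4)])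
        show "length x + length r < length u + length v"
          using sum arg_cong[OF r(1), of length] pos unfolding length_append by linarith
        show "length r = length r'" "length s = length s'"
          using len r(1,2) r'(1,2) less.prems(8) by simp_all
      qed fact+
      then show ?thesis using r(1) r'(1) by simp
    next
      case 2
      obtain r s where r: "y = r @ x" "x @ r = w @ c # d # s" "r @ x = w @ d # c # s"
        using almost_commuting_suffix[OF eq(1,2)] lt 2 by (metis less_imp_le)
      have "length x' \<le> length y'" "length x' \<le> length z'"
        using total len lt 2 less.prems(8) by linarith+
      then obtain r' s' where r': "y' = r' @ x'"
        "x' @ r' = w' @ c # d # s'" "r' @ x' = w' @ d # c # s'"
        using almost_commuting_suffix[OF eq(3,4)] by metis
      have "x = x' \<and> r = r'"
      proof (rule less.hyps[OF _ r(2,3) r'(2,3)])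
        show "length x + length r < length u + length v"
          using sum arg_cong[OF r(1), of length] pos unfolding length_append by linarith
        show "length r = length r'"
          using len r(1) r'(1) by simp
      qed fact+
      then show ?thesis using r(1) r'(1) by simp
    qed
  qed
  consider "length u < length v" | "length u = length v" | "length v < length u"
    by linarith
  then show ?case
  proof cases
    case 1
    then show ?thesis
      using shorter[OF less.prems(1-7)] by blast
  next
    case 2
    then show ?thesis
      using almost_commuting_same_length[OF less.prems(1,2,5)]
        almost_commuting_same_length[OF less.prems(3,4,5)] less.prems(6,7) by simp
  next
    case 3
    then show ?thesis
      using shorter[OF less.prems(2,1,4,3) _ less.prems(7,6)] less.prems(5) by simp
  qed
qed

section \<open>Recovering a morphism from its matrix\<close>

text \<open>Reduces equality of two members of the monoid to equality of their images of the two
  letters.\<close>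

lemma foldr_comp_eq_subst:
  assumes "set ps \<subseteq> gen_pairs"
  shows "\<exists>u v. foldr (\<circ>) (map fst ps) id = subst u v"
  using assms
proof (induction ps)
  case Nil
  have "id w = subst [L0] [L1] w" for w
  proof (induction w)
    case (Cons a w)
    then show ?case by (cases a) auto
  qed simp
  then have "foldr (\<circ>) (map fst []) id = subst [L0] [L1]"
    by auto
  then show ?case by blast
next
  case (Cons p ps)
  then have "set ps \<subseteq> gen_pairs"
    by simp
  then obtain u v where uv: "foldr (\<circ>) (map fst ps) id = subst u v"
    using Cons.IH by blast
  obtain x y where xy: "fst p = subst x y"
    using Cons.prems
    by (auto simp: gen_pairs_def morph_G_def morph_Gt_def morph_D_def morph_Dt_def)
  have "subst x y (subst u v w) = subst (subst x y u) (subst x y v) w" for w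
  proof (induction w)
    case (Cons a w)
    then show ?case by (cases a) auto
  qed simp
  then have "foldr (\<circ>) (map fst (p # ps)) id = subst (subst x y u) (subst x y v)"
    using uv xy by auto
  then show ?case by blast
qed

lemma det_foldr_gen_pairs:
  assumes "set ps \<subseteq> gen_pairs"
  shows "det (foldr (**) (map snd ps) (mat 1)) = 1"
proof -
  have "det (snd p) = 1" if "p \<in> gen_pairs" for p
    using that by (auto simp: gen_pairs_def mat_G_def mat_Gt_def mat_D_def mat_Dt_def det_3)
  with assms show ?thesis
    by (induction ps) (auto simp: det_mul)
qed

lemma length_letters: "length w = count_list w L0 + count_list w L1"
proof (induction w)
  case (Cons a w)
  then show ?case by (cases a) auto
qed simp

lemma rep_spec_inj:
  assumes f: "rep_spec f w A" and g: "rep_spec g w' A" and det: "det A \<noteq> 0"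
    and subst: "f = subst u v" "g = subst u' v'"
  shows "f = g"
proof -
  define a b c d where abcd:
    "a = count_list u L0" "b = count_list v L0" "c = count_list u L1" "d = count_list v L1"
  have A: "A = vector [vector [real a, real b, 0], vector [real c, real d, 0],
      vector [real a - 1 - real (count_list w L0) * real c + real (count_list w L1) * real a,
        real b - real (count_list w L0) * real d + real (count_list w L1) * real b, 1]]"
    using f unfolding rep_spec_def subst abcd by simp
  have A': "A = vector [vector [real (count_list u' L0), real (count_list v' L0), 0],
      vector [real (count_list u' L1), real (count_list v' L1), 0],
      vector [real (count_list u' L0) - 1 - real (count_list w' L0) * real (count_list u' L1)
          + real (count_list w' L1) * real (count_list u' L0),
        real (count_list v' L0) - real (count_list w' L0) * real (count_list v' L1)
          + real (count_list w' L1) * real (count_list v' L0), 1]]"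
    using g unfolding rep_spec_def subst by simp
  have counts: "count_list u' L0 = a" "count_list v' L0 = b"
      "count_list u' L1 = c" "count_list v' L1 = d"
    using A A' by (simp_all add: vec_eq_iff forall_3)
  define p q where pq: "p = real (count_list w L0) - real (count_list w' L0)"
    "q = real (count_list w L1) - real (count_list w' L1)"
  \<comment> \<open>Subtracting the two expressions for the last row leaves a homogeneous system for
    the difference \<open>(p, q)\<close> of the Parikh vectors of \<open>w\<close> and
    \<open>w'\<close>.\<close>
  have row: "p * c = q * a" "p * d = q * b"
    using A A' unfolding counts pq by (simp_all add: vec_eq_iff forall_3 algebra_simps)
  \<comment> \<open>The last column of \<open>A\<close> is the third unit vector, so
    \<open>det A\<close> is the determinant of the upper left block.\<close>
  have "real a * d - real b * c \<noteq> 0"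
    using det unfolding A by (simp add: det_3)
  moreover have "p * (real a * d - real b * c) = 0" "q * (real a * d - real b * c) = 0"
    using row by algebra+
  ultimately have "p = 0" "q = 0"
    by simp_all
  then have "length w = length w'"
    unfolding pq length_letters by simp
  moreover have "length u = length u'" "length v = length v'"
    using counts unfolding abcd length_letters by simp_all
  moreover obtain z where "u @ v = w @ L0 # L1 # z" "v @ u = w @ L1 # L0 # z"
    using f unfolding rep_spec_def subst by auto
  moreover obtain z' where "u' @ v' = w' @ L0 # L1 # z'" "v' @ u' = w' @ L1 # L0 # z'"
    using g unfolding rep_spec_def subst by auto
  ultimately have "u = u' \<and> v = v'"
    by (intro almost_commuting_pair_unique[where w = w and w' = w']) auto
  then show ?thesis
    using subst by simp
qed

section \<open>Homomorphism property and injectivity\<close>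

lemma foldr_comp_append:
  "foldr (\<circ>) (fs @ gs) id = foldr (\<circ>) fs id \<circ> foldr (\<circ>) gs (id :: 'a \<Rightarrow> 'a)"
  by (induction fs) (simp_all add: comp_assoc)

lemma foldr_matrix_mult_append:
  "foldr (**) (As @ Bs) (mat 1) = foldr (**) As (mat 1) ** foldr (**) Bs (mat 1 :: real^'n^'n)"
  by (induction As) (simp_all add: matrix_mul_assoc)

theorem proposition6:
  shows "sturmian_rep id = mat 1 \<and>
    (\<forall>\<phi>\<in>special_sturmian. \<forall>\<psi>\<in>special_sturmian.
       sturmian_rep (\<phi> \<circ> \<psi>) = sturmian_rep \<phi> ** sturmian_rep \<psi>) \<and>
    inj_on sturmian_rep special_sturmian"
proof (intro conjI ballI inj_onI)
  show "sturmian_rep id = mat 1"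
    using sturmian_rep_decomposition[of "[]"] by simp
next
  fix \<phi> \<psi>
  assume "\<phi> \<in> special_sturmian" "\<psi> \<in> special_sturmian"
  then obtain ps qs where
    ps: "set ps \<subseteq> gen_pairs" "\<phi> = foldr (\<circ>) (map fst ps) id" and
    qs: "set qs \<subseteq> gen_pairs" "\<psi> = foldr (\<circ>) (map fst qs) id"
    using special_sturmian_decomposes by metis
  \<comment> \<open>Concatenated decompositions decompose the composite, and its matrix may be
    computed from any decomposition.\<close>
  have "sturmian_rep (\<phi> \<circ> \<psi>) = sturmian_rep (foldr (\<circ>) (map fst (ps @ qs)) id)"
    unfolding ps qs map_append foldr_comp_append ..
  also have "\<dots> = foldr (**) (map snd (ps @ qs)) (mat 1)"
    using ps qs by (intro sturmian_rep_decomposition) simp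
  also have "\<dots> = sturmian_rep \<phi> ** sturmian_rep \<psi>"
    unfolding ps(2) qs(2) sturmian_rep_decomposition[OF ps(1)]
      sturmian_rep_decomposition[OF qs(1)] map_append foldr_matrix_mult_append ..
  finally show "sturmian_rep (\<phi> \<circ> \<psi>) = sturmian_rep \<phi> ** sturmian_rep \<psi>" .
next
  fix \<phi> \<psi>
  assume "\<phi> \<in> special_sturmian" "\<psi> \<in> special_sturmian" and eq: "sturmian_rep \<phi> = sturmian_rep \<psi>"
  then obtain ps qs where
    ps: "set ps \<subseteq> gen_pairs" "\<phi> = foldr (\<circ>) (map fst ps) id" and
    qs: "set qs \<subseteq> gen_pairs" "\<psi> = foldr (\<circ>) (map fst qs) id"
    using special_sturmian_decomposes by metis
  have "det (sturmian_rep \<phi>) \<noteq> 0"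
    unfolding ps(2) sturmian_rep_decomposition[OF ps(1)] det_foldr_gen_pairs[OF ps(1)] by simp
  moreover obtain w w' where "rep_spec \<phi> w (sturmian_rep \<phi>)" "rep_spec \<psi> w' (sturmian_rep \<phi>)"
    using rep_spec_decomposition[OF ps(1)] rep_spec_decomposition[OF qs(1)] eq ps qs
      sturmian_rep_decomposition by metis
  moreover obtain u v u' v' where "\<phi> = subst u v" "\<psi> = subst u' v'"
    using foldr_comp_eq_subst ps qs by metis
  ultimately show "\<phi> = \<psi>"
    using rep_spec_inj by metis
qed

end
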